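(* Let $X$ be a finite dimensional Banach space. Suppose that a (closed linear) subspace $H$ of $C_b(B_X,X)$ contains all the functions of the form $1\otimes x$ and $y^*\otimes z$, for all $x\in X$, $z\in X$ and $y^*\in X^*$. Then $H$ has the numerical Shilov boundary.
   Context: $B_X$ and $S_X$ are the closed unit ball and unit sphere of $X$. $C_b(B_X,X)$ is the Banach space of bounded continuous functions $B_X\to X$ with the sup norm; "subspace" means closed linear subspace. $1\otimes x$ is the constant function with value $x$, and $(y^*\otimes z)(u)=y^*(u)z$ for $u\in B_X$. $\Pi_X=\{(x,x^* )\in S_X\times S_{X^*}: x^*(x)=1\}$, with the topology $\tau$ induced from $B_X\times B_{X^*}$, where $B_X$ carries the norm topology and $B_{X^*}$ the weak-$*$ topology. The numerical radius of $f\in C_b(B_X,X)$ is $v(f)=\sup\{|x^*(f(x))|:(x,x^* )\in\Pi_X\}$. $B\subset\Pi_X$ is a numerical boundary for $H$ if $v(f)=\sup_{(x,x^* )\in B}|x^*(f(x))|$ for all $f\in H$. $H$ has the numerical Shilov boundary if there is a smallest ($\tau$-)closed numerical boundary for $H$, i.e. one contained in every closed numerical boundary for $H$. *)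

theory Defs
  imports "HOL-Analysis.Analysis"
begin

section \<open>Normed spaces over the real or the complex field\<close>

text \<open>
  The scalar field is a type \<open>'k\<close> of sort \<open>{real_normed_field, euclidean_space}\<close>.  The types
  \<open>real\<close> and \<open>complex\<close> are of this sort, and up to isometric isomorphism they are the only
  such fields (a commutative finite-dimensional real division algebra with a multiplicative norm).
  A normed space over \<open>'k\<close> is a type with a norm together with a scalar multiplication \<open>scl\<close>;
  \<open>scaleR\<close>, which the library attaches to the type, is the restriction of \<open>scl\<close> to real scalars.
\<close>

locale normed_space_over = vector_space scl
  for scl :: "'k::{real_normed_field, euclidean_space} \<Rightarrow> 'a::real_normed_vector \<Rightarrow> 'a" +
  assumes norm_scale: "norm (scl c x) = norm c * norm x"
    and scale_of_real: "scl (of_real r) x = r *\<^sub>R x"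

definition finite_dim :: "('k::field \<Rightarrow> 'a::ab_group_add \<Rightarrow> 'a) \<Rightarrow> bool" where
  "finite_dim scl \<longleftrightarrow> (\<exists>Bs. finite_dimensional_vector_space scl Bs)"

definition dual_space :: "('k::real_normed_field \<Rightarrow> 'a::real_normed_vector \<Rightarrow> 'a) \<Rightarrow> ('a \<Rightarrow> 'k) set" where
  "dual_space scl = {\<phi>. Vector_Spaces.linear scl (*) \<phi> \<and> (\<exists>K. \<forall>x. norm (\<phi> x) \<le> K * norm x)}"

definition dual_ball :: "('k::real_normed_field \<Rightarrow> 'a::real_normed_vector \<Rightarrow> 'a) \<Rightarrow> ('a \<Rightarrow> 'k) set" where
  "dual_ball scl = {\<phi> \<in> dual_space scl. onorm \<phi> \<le> 1}"

text \<open>The weak-* topology is the topology of pointwise convergence on \<open>X\<close>.\<close>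

definition weak_star_ball ::
    "('k::real_normed_field \<Rightarrow> 'a::real_normed_vector \<Rightarrow> 'a) \<Rightarrow> ('a \<Rightarrow> 'k) topology" where
  "weak_star_ball scl =
     subtopology (product_topology (\<lambda>_::'a. euclidean :: 'k topology) UNIV) (dual_ball scl)"


section \<open>The closed unit ball as a metric space\<close>

text \<open>
  Having \<open>B\<^sub>X\<close> as a type makes \<open>C\<^sub>b(B\<^sub>X, X)\<close> the library type \<open>'a unit_ball \<Rightarrow>\<^sub>C 'a\<close>, whose norm is
  the supremum norm.
\<close>

typedef (overloaded) ('a::real_normed_vector) unit_ball = "cball (0::'a) 1"
  morphisms of_ball Abs_unit_ball
  by (rule exI[of _ 0]) simp

instantiation unit_ball :: (real_normed_vector) metric_space
begin

definition dist_unit_ball :: "'a unit_ball \<Rightarrow> 'a unit_ball \<Rightarrow> real" where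
  "dist_unit_ball u v = dist (of_ball u) (of_ball v)"

definition uniformity_unit_ball :: "('a unit_ball \<times> 'a unit_ball) filter" where
  "uniformity_unit_ball = (INF e\<in>{0<..}. principal {(u, v). dist u v < e})"

definition open_unit_ball :: "'a unit_ball set \<Rightarrow> bool" where
  "open_unit_ball U \<longleftrightarrow> (\<forall>u\<in>U. \<forall>\<^sub>F (u', v) in uniformity. u' = u \<longrightarrow> v \<in> U)"

instance
proof
  fix u v w :: "'a unit_ball"
  show "dist u v = 0 \<longleftrightarrow> u = v"
    by (simp add: dist_unit_ball_def of_ball_inject)
  show "dist u v \<le> dist u w + dist v w"
    unfolding dist_unit_ball_def by (rule dist_triangle2)
qed (simp_all add: uniformity_unit_ball_def open_unit_ball_def)

end

lemma norm_of_ball: "norm (of_ball u) \<le> 1"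
  using of_ball[of u] by simp

lemma continuous_on_of_ball: "continuous_on S of_ball"
  unfolding continuous_on_iff by (auto simp: dist_unit_ball_def)


section \<open>Subspaces of the space of bounded continuous functions\<close>

definition scale_bcontfun ::
    "('k \<Rightarrow> 'a \<Rightarrow> 'a) \<Rightarrow> 'k \<Rightarrow> ('b::metric_space \<Rightarrow>\<^sub>C 'a::real_normed_vector) \<Rightarrow> ('b \<Rightarrow>\<^sub>C 'a)" where
  "scale_bcontfun scl c f = Bcontfun (\<lambda>u. scl c (apply_bcontfun f u))"

definition closed_subspace ::
    "('k::real_normed_field \<Rightarrow> 'a \<Rightarrow> 'a) \<Rightarrow> ('b::metric_space \<Rightarrow>\<^sub>C 'a::real_normed_vector) set \<Rightarrow> bool" where
  "closed_subspace scl H \<longleftrightarrow> module.subspace (scale_bcontfun scl) H \<and> closed H"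

text \<open>The function \<open>1 \<otimes> x\<close> is \<open>const_bcontfun x\<close>; \<open>y \<otimes> z\<close>, for a functional \<open>y\<close>, is:\<close>

definition tensor ::
    "('k::real_normed_field \<Rightarrow> 'a \<Rightarrow> 'a) \<Rightarrow> ('a \<Rightarrow> 'k) \<Rightarrow> 'a \<Rightarrow> ('a unit_ball \<Rightarrow>\<^sub>C 'a::real_normed_vector)" where
  "tensor scl y z = Bcontfun (\<lambda>u. scl (y (of_ball u)) z)"

text \<open>
  The arguments of \<open>Bcontfun\<close> above are bounded and continuous, and \<open>scale_bcontfun\<close> is a vector
  space structure.
\<close>

context normed_space_over
begin

lemma bounded_linear_scale_right: "bounded_linear (scl c)"
proof (rule bounded_linear_intro[where K = "norm c"])
  fix r x
  show "scl c (r *\<^sub>R x) = r *\<^sub>R scl c x"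
    by (simp add: scale_of_real[symmetric] mult.commute)
qed (simp_all add: scale_right_distrib norm_scale)

lemma bounded_linear_scale_left: "bounded_linear (\<lambda>c. scl c x)"
proof (rule bounded_linear_intro[where K = "norm x"])
  fix r :: real and c
  show "scl (r *\<^sub>R c) x = r *\<^sub>R scl c x"
    by (simp add: scale_of_real[symmetric] scaleR_conv_of_real)
qed (simp_all add: scale_left_distrib norm_scale)

lemma apply_scale_bcontfun [simp]:
  "apply_bcontfun (scale_bcontfun scl c f) u = scl c (apply_bcontfun f u)"
proof -
  have "(\<lambda>u. scl c (apply_bcontfun f u)) \<in> bcontfun"
    using apply_bcontfun[of f]
      bounded_linear_image[OF _ bounded_linear_scale_right, of "range (apply_bcontfun f)" c]
      bounded_linear.continuous_on[OF bounded_linear_scale_right, of UNIV "apply_bcontfun f" c]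
    by (simp add: bcontfun_def image_image)
  then show ?thesis
    by (simp add: scale_bcontfun_def Bcontfun_inverse)
qed

lemma vector_space_scale_bcontfun:
  "vector_space (scale_bcontfun scl :: 'k \<Rightarrow> ('b::metric_space \<Rightarrow>\<^sub>C 'a) \<Rightarrow> ('b \<Rightarrow>\<^sub>C 'a))"
  by unfold_locales
    (auto intro!: bcontfun_eqI simp: scale_right_distrib scale_left_distrib plus_bcontfun.rep_eq)

lemma dual_space_bounded_linear:
  assumes "\<phi> \<in> dual_space scl"
  shows "bounded_linear \<phi>"
proof -
  interpret L: Vector_Spaces.linear scl "(*)" \<phi>
    using assms by (simp add: dual_space_def)
  obtain K where K: "\<And>x. norm (\<phi> x) \<le> K * norm x"
    using assms by (auto simp: dual_space_def)
  show ?thesis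
  proof (rule bounded_linear_intro[where K = K])
    fix r x
    show "\<phi> (r *\<^sub>R x) = r *\<^sub>R \<phi> x"
      using L.scale[of "of_real r" x] by (simp add: scale_of_real scaleR_conv_of_real)
  qed (simp_all add: L.add K mult.commute)
qed

lemma apply_tensor:
  assumes "y \<in> dual_space scl"
  shows "apply_bcontfun (tensor scl y z) u = scl (y (of_ball u)) z"
proof -
  have lin: "bounded_linear (\<lambda>x. scl (y x) z)"
    by (rule bounded_linear_compose[OF bounded_linear_scale_left dual_space_bounded_linear[OF assms]])
  have "bounded (range (of_ball :: 'a unit_ball \<Rightarrow> 'a))"
    using norm_of_ball by (auto simp: bounded_iff)
  from bounded_linear_image[OF this lin]
  have "(\<lambda>u. scl (y (of_ball u)) z) \<in> bcontfun"
    using bounded_linear.continuous_on[OF lin continuous_on_of_ball[of UNIV]]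
    by (simp add: bcontfun_def image_image)
  then show ?thesis
    by (simp add: tensor_def Bcontfun_inverse)
qed

end


section \<open>Numerical radius, numerical boundaries and the numerical Shilov boundary\<close>

definition Pi_set ::
    "('k::real_normed_field \<Rightarrow> 'a::real_normed_vector \<Rightarrow> 'a) \<Rightarrow> ('a unit_ball \<times> ('a \<Rightarrow> 'k)) set" where
  "Pi_set scl = {(x, \<phi>). norm (of_ball x) = 1 \<and> \<phi> \<in> dual_space scl \<and> onorm \<phi> = 1 \<and> \<phi> (of_ball x) = 1}"

definition tau ::
    "('k::real_normed_field \<Rightarrow> 'a::real_normed_vector \<Rightarrow> 'a) \<Rightarrow> ('a unit_ball \<times> ('a \<Rightarrow> 'k)) topology" where
  "tau scl = subtopology (prod_topology euclidean (weak_star_ball scl)) (Pi_set scl)"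

text \<open>
  The values are nonnegative, so inserting 0 only fixes the convention that the supremum over the
  empty set is 0.
\<close>

definition num_sup ::
    "('a unit_ball \<times> ('a \<Rightarrow> 'k::real_normed_field)) set \<Rightarrow> ('a unit_ball \<Rightarrow>\<^sub>C 'a::real_normed_vector) \<Rightarrow> real" where
  "num_sup B f = Sup (insert 0 ((\<lambda>(x, \<phi>). norm (\<phi> (apply_bcontfun f x))) ` B))"

definition numerical_radius ::
    "('k::real_normed_field \<Rightarrow> 'a \<Rightarrow> 'a) \<Rightarrow> ('a unit_ball \<Rightarrow>\<^sub>C 'a::real_normed_vector) \<Rightarrow> real" where
  "numerical_radius scl f = num_sup (Pi_set scl) f"

definition numerical_boundary ::
    "('k::real_normed_field \<Rightarrow> 'a \<Rightarrow> 'a) \<Rightarrow> ('a unit_ball \<Rightarrow>\<^sub>C 'a::real_normed_vector) set \<Rightarrow>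
     ('a unit_ball \<times> ('a \<Rightarrow> 'k)) set \<Rightarrow> bool" where
  "numerical_boundary scl H B \<longleftrightarrow>
     B \<subseteq> Pi_set scl \<and> (\<forall>f\<in>H. numerical_radius scl f = num_sup B f)"

definition closed_numerical_boundary ::
    "('k::real_normed_field \<Rightarrow> 'a \<Rightarrow> 'a) \<Rightarrow> ('a unit_ball \<Rightarrow>\<^sub>C 'a::real_normed_vector) set \<Rightarrow>
     ('a unit_ball \<times> ('a \<Rightarrow> 'k)) set \<Rightarrow> bool" where
  "closed_numerical_boundary scl H B \<longleftrightarrow> numerical_boundary scl H B \<and> closedin (tau scl) B"

definition has_numerical_Shilov_boundary ::
    "('k::real_normed_field \<Rightarrow> 'a \<Rightarrow> 'a) \<Rightarrow> ('a unit_ball \<Rightarrow>\<^sub>C 'a::real_normed_vector) set \<Rightarrow> bool" where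
  "has_numerical_Shilov_boundary scl H \<longleftrightarrow>
     (\<exists>B. closed_numerical_boundary scl H B \<and>
          (\<forall>C. closed_numerical_boundary scl H C \<longrightarrow> B \<subseteq> C))"

lemma normed_space_over_real: "normed_space_over (scaleR :: real \<Rightarrow> 'a::real_normed_vector \<Rightarrow> 'a)"
  by unfold_locales (simp_all add: scaleR_right_distrib scaleR_left_distrib)

lemma normed_space_over_complex: "normed_space_over ((*) :: complex \<Rightarrow> complex \<Rightarrow> complex)"
  by unfold_locales (simp_all add: algebra_simps norm_mult scaleR_conv_of_real)

end

(*
  A function f in H is viewed as the function (x, \<phi>) \<mapsto> \<phi>(f(x)) on the compact space Pi_X.
  For a basis (e_i) of X with dual basis (e_i'), the values of the finitely many functions
  1 \<otimes> e_j and e_i' \<otimes> e_j assemble to a map G from Pi_X to a finite-dimensional Hilbert space,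
  and G separates points even up to a scalar factor.  Given f, let t0 maximise the norm of G
  over the compact set where |f| is maximal.  By the equality case of Cauchy-Schwarz,
  g = <G, G(t0)> peaks in modulus on that set at t0 alone.  After rotating f so that
  f(t0) \<ge> 0, the maxima of |f + \<epsilon> g| therefore accumulate only at t0 as \<epsilon> \<rightarrow> 0, so t0 lies in
  every closed numerical boundary.  Hence the intersection of all closed numerical boundaries
  still contains a point where |f| is maximal, for every f in H.
*)

theory Submission
  imports Defs
begin

section \<open>Compactness of preimages and of products\<close>

lemma compact_Collect_closed:
  assumes "compact S" "continuous_on S f" "closed T"
  shows "compact {x \<in> S. f x \<in> T}"
proof -
  have "{x \<in> S. f x \<in> T} = S \<inter> f -` T"
    by auto
  with continuous_closedin_preimage[OF assms(2,3)] closedin_compact[OF assms(1)]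
  show ?thesis by metis
qed

text \<open>Tychonoff's theorem, moved to the type-class topology on functions, which is that of
  pointwise convergence.\<close>

lemma compact_Pi:
  fixes X :: "'i \<Rightarrow> 'b::topological_space set"
  assumes "\<And>i. compact (X i)"
  shows "compact (Pi UNIV X)"
proof -
  have "compactin (product_topology (\<lambda>_. euclidean) UNIV) (PiE UNIV X)"
    using assms by (simp add: compactin_PiE)
  then show ?thesis
    by (simp add: euclidean_product_topology PiE_UNIV_domain)
qed

section \<open>Conjugation in the scalar field and the equality case of Cauchy-Schwarz\<close>

text \<open>
  Complex conjugation for the abstract scalar field, characterised by \<open>inner_eq_cnj_like\<close>
  below; division by zero gives \<open>cnj_like 0 = 0\<close>.
\<close>

definition cnj_like :: "'k::{real_normed_field, euclidean_space} \<Rightarrow> 'k" where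
  "cnj_like w = of_real ((norm w)\<^sup>2) / w"

text \<open>The norm is multiplicative, and polarisation carries this over to the inner
  product.\<close>

lemma inner_mult_left_cancel:
  fixes u v w :: "'k::{real_normed_field, euclidean_space}"
  shows "inner (w * u) (w * v) = (norm w)\<^sup>2 * inner u v"
proof -
  have "norm (w * u + w * v) = norm w * norm (u + v)"
    by (simp flip: norm_mult distrib_left)
  then show ?thesis
    by (simp add: dot_norm norm_mult power_mult_distrib field_simps)
qed

text \<open>Writing \<open>z\<close> as \<open>w * (z / w)\<close> lets the factor \<open>w\<close>
  be pulled out of both arguments. \<open>inner 1\<close> plays the role of the real part.\<close>

lemma inner_eq_cnj_like:
  fixes w z :: "'k::{real_normed_field, euclidean_space}"
  shows "inner w z = inner 1 (cnj_like w * z)"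
proof (cases "w = 0")
  case False
  have "inner w z = inner (w * 1) (w * (z / w))"
    using False by simp
  also have "\<dots> = inner 1 ((norm w)\<^sup>2 *\<^sub>R (z / w))"
    unfolding inner_mult_left_cancel by simp
  finally show ?thesis
    by (simp add: cnj_like_def scaleR_conv_of_real)
qed (simp add: cnj_like_def)

lemma cnj_like_mult_self: "cnj_like w * w = of_real ((norm w)\<^sup>2)"
  by (simp add: cnj_like_def)

text \<open>With \<open>d\<close> the phase of the scalar product \<gamma>, the squared distance
  from \<open>z\<close> to \<open>d * w\<close> expands to |z|^2 + |w|^2 - 2|\<gamma>|, which the
  two hypotheses make nonpositive.\<close>

lemma Cauchy_Schwarz_equality:
  fixes w z :: "'i \<Rightarrow> 'k::{real_normed_field, euclidean_space}"
  assumes fin: "finite A"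
    and le: "(\<Sum>a\<in>A. (norm (z a))\<^sup>2) \<le> (\<Sum>a\<in>A. (norm (w a))\<^sup>2)"
    and ge: "(\<Sum>a\<in>A. (norm (w a))\<^sup>2) \<le> norm (\<Sum>a\<in>A. cnj_like (w a) * z a)"
  obtains d where "\<And>a. a \<in> A \<Longrightarrow> z a = d * w a"
proof -
  define \<gamma> where "\<gamma> = (\<Sum>a\<in>A. cnj_like (w a) * z a)"
  \<comment> \<open>For \<gamma> = 0 any unit scalar satisfies the two facts below; 1 is
    chosen.\<close>
  define d where "d = (if \<gamma> = 0 then 1 else \<gamma> / of_real (norm \<gamma>))"
  have d1: "norm d = 1"
    by (simp add: d_def norm_divide)
  have d\<gamma>: "\<gamma> / d = of_real (norm \<gamma>)"
    by (simp add: d_def)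
  have "(\<Sum>a\<in>A. inner (d * w a) (z a)) = (\<Sum>a\<in>A. inner 1 (cnj_like (w a) * z a / d))"
  proof (rule sum.cong)
    fix a
    have "cnj_like (d * w a) * z a = cnj_like (w a) * z a / d"
      using d1 by (simp add: cnj_like_def norm_mult)
    then show "inner (d * w a) (z a) = inner 1 (cnj_like (w a) * z a / d)"
      by (subst inner_eq_cnj_like) simp
  qed simp
  also have "\<dots> = inner 1 (\<gamma> / d)"
    by (simp add: \<gamma>_def inner_sum_right sum_divide_distrib)
  also have "\<dots> = norm \<gamma>"
    unfolding d\<gamma> by (simp add: of_real_def dot_square_norm)
  finally have ip: "(\<Sum>a\<in>A. inner (d * w a) (z a)) = norm \<gamma>" .
  have "(\<Sum>a\<in>A. (norm (z a - d * w a))\<^sup>2)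
      = (\<Sum>a\<in>A. (norm (z a))\<^sup>2 + (norm (w a))\<^sup>2 - 2 * inner (d * w a) (z a))"
    by (rule sum.cong)
      (simp_all add: power2_norm_eq_inner inner_diff_left inner_diff_right inner_commute
        inner_mult_left_cancel d1)
  also have "\<dots> = (\<Sum>a\<in>A. (norm (z a))\<^sup>2) + (\<Sum>a\<in>A. (norm (w a))\<^sup>2) - 2 * norm \<gamma>"
    by (simp add: sum.distrib sum_subtractf ip flip: sum_distrib_left)
  also have "\<dots> \<le> 0"
    using le ge by (simp add: \<gamma>_def)
  finally have "(\<Sum>a\<in>A. (norm (z a - d * w a))\<^sup>2) = 0"
    by (intro order_antisym sum_nonneg) auto
  then have "\<forall>a\<in>A. (norm (z a - d * w a))\<^sup>2 = 0"
    using fin by (subst (asm) sum_nonneg_eq_0_iff) auto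
  then show thesis
    by (intro that[of d]) simp
qed

section \<open>Peak points for a space of functions on a compact space\<close>

text \<open>The point \<open>t0\<close> is chosen before \<open>C\<close>, so one point serves all
  closed boundaries at once. Separation is up to a factor \<open>d\<close> because the equality case
  of Cauchy-Schwarz determines the values only that far.\<close>

lemma maximiser_in_all_closed_boundaries:
  fixes K :: "'t::topological_space set"
    and V :: "('t \<Rightarrow> 'k::{real_normed_field, euclidean_space}) set"
  assumes K: "compact K" "K \<noteq> {}"
    and cont: "\<And>f. f \<in> V \<Longrightarrow> continuous_on K f"
    and add: "\<And>f g. f \<in> V \<Longrightarrow> g \<in> V \<Longrightarrow> (\<lambda>t. f t + g t) \<in> V"
    and mult: "\<And>c f. f \<in> V \<Longrightarrow> (\<lambda>t. c * f t) \<in> V"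
    and A: "finite A" "A \<subseteq> V"
    and sep: "\<And>s t d. s \<in> K \<Longrightarrow> t \<in> K \<Longrightarrow> (\<And>a. a \<in> A \<Longrightarrow> a t = d * a s) \<Longrightarrow> t = s"
    and f: "f \<in> V"
  shows "\<exists>t0\<in>K. (\<forall>t\<in>K. norm (f t) \<le> norm (f t0)) \<and>
    (\<forall>C. compact C \<and> C \<subseteq> K \<and> (\<forall>h\<in>V. \<forall>t\<in>K. \<exists>s\<in>C. norm (h t) \<le> norm (h s)) \<longrightarrow> t0 \<in> C)"
proof -
  obtain m where m: "m \<in> K" "\<And>t. t \<in> K \<Longrightarrow> norm (f t) \<le> norm (f m)"
    using continuous_attains_sup[OF K, of "\<lambda>t. norm (f t)"] cont[OF f]
    by (auto intro: continuous_intros)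
  define v where "v = norm (f m)"
  define M where "M = {t \<in> K. norm (f t) \<in> {v}}"
  define Q where "Q t = (\<Sum>a\<in>A. (norm (a t))\<^sup>2)" for t
  have "compact M"
    unfolding M_def by (intro compact_Collect_closed K continuous_intros cont f)
  moreover have "m \<in> M"
    using m by (simp add: M_def v_def)
  moreover have "continuous_on M Q"
    unfolding Q_def using A cont
    by (intro continuous_intros) (auto simp: M_def intro: continuous_on_subset)
  ultimately obtain t0 where t0: "t0 \<in> M" "\<And>t. t \<in> M \<Longrightarrow> Q t \<le> Q t0"
    using continuous_attains_sup[of M Q] by auto
  have t0K: "t0 \<in> K" and ft0: "norm (f t0) = v"
    using t0 by (auto simp: M_def)
  \<comment> \<open>The rotation that makes \<open>f t0\<close> real and nonnegative; if
    \<open>f t0 = 0\<close>, then \<open>v = 0\<close> and 1 will do.\<close>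
  define c where "c = (if f t0 = 0 then 1 else of_real v / f t0)"
  have c1: "norm c = 1" and cf: "c * f t0 = of_real v"
    using ft0 by (auto simp: c_def norm_divide)
  define g where "g t = (\<Sum>a\<in>A. cnj_like (a t0) * a t)" for t
  \<comment> \<open>For the empty sum, the zero function is obtained as the multiple
    \<open>0 * f\<close>.\<close>
  have "(\<lambda>t. \<Sum>a\<in>A'. cnj_like (a t0) * a t) \<in> V" if "finite A'" "A' \<subseteq> A" for A'
    using that
  proof induction
    case empty
    show ?case using mult[OF f, of 0] by simp
  next
    case (insert a A')
    then show ?case using A add[OF mult[of a]] by auto
  qed
  then have gV: "g \<in> V"
    using A unfolding g_def[abs_def] by blast
  have gt0: "g t0 = of_real (Q t0)"
    by (simp add: g_def Q_def cnj_like_mult_self)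
  show ?thesis
  proof (intro bexI[OF _ t0K] conjI ballI allI impI; (elim conjE)?)
    show "norm (f t) \<le> norm (f t0)" if "t \<in> K" for t
      using m(2)[OF that] ft0 by (simp add: v_def)
    fix C
    assume C: "compact C" "C \<subseteq> K"
      and bd: "\<forall>h\<in>V. \<forall>t\<in>K. \<exists>s\<in>C. norm (h t) \<le> norm (h s)"
    have Q0: "0 \<le> Q t0"
      by (simp add: Q_def sum_nonneg)
    have v0: "0 \<le> v"
      by (simp add: v_def)
    obtain R where R: "\<And>t. t \<in> K \<Longrightarrow> norm (g t) \<le> R"
      using compact_imp_bounded[OF compact_continuous_image[OF cont[OF gV] K(1)]]
      by (auto simp: bounded_iff)
    \<comment> \<open>Test \<open>C\<close> with \<open>c * f + e * g\<close> at \<open>t0\<close>,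
      where both terms are nonnegative reals and add without cancellation. At the resulting
      \<open>s\<close>, \<open>norm (f s)\<close> is at most \<open>v\<close>, so \<open>g\<close>
      must supply \<open>Q t0\<close>; and \<open>e * norm (g s)\<close> is at most
      \<open>e * R\<close>, so \<open>f\<close> must supply the rest.\<close>
    have pert: "\<exists>s\<in>C. Q t0 \<le> norm (g s) \<and> v - e * R \<le> norm (f s)" if e: "e > 0" for e
    proof -
      have "(\<lambda>t. c * f t + of_real e * g t) \<in> V"
        by (intro add mult f gV)
      from bd[rule_format, OF this t0K] obtain s where s: "s \<in> C"
        and le: "norm (c * f t0 + of_real e * g t0) \<le> norm (c * f s + of_real e * g s)"
        by auto
      have "c * f t0 + of_real e * g t0 = of_real (v + e * Q t0)"
        by (simp add: cf gt0)
      then have "v + e * Q t0 = norm (c * f t0 + of_real e * g t0)"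
        using e Q0 v0 by (simp only: norm_of_real) simp
      also note le
      also have "norm (c * f s + of_real e * g s) \<le> norm (f s) + e * norm (g s)"
        using norm_triangle_ineq[of "c * f s" "of_real e * g s"] e c1 by (simp add: norm_mult)
      finally have *: "v + e * Q t0 \<le> norm (f s) + e * norm (g s)" .
      have "norm (f s) \<le> v"
        using m(2) s C by (auto simp: v_def)
      with * have "e * Q t0 \<le> e * norm (g s)"
        by simp
      then have "Q t0 \<le> norm (g s)"
        using e by simp
      moreover have "e * norm (g s) \<le> e * R" "0 \<le> e * Q t0"
        using R[of s] s C e Q0 by auto
      then have "v - e * R \<le> norm (f s)"
        using * by linarith
      ultimately show ?thesis
        using s by blast
    qed
    \<comment> \<open>\<open>D\<close> does not depend on \<open>e\<close>, so a maximiser of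
      \<open>norm f\<close> on it is as good as all the perturbed points together and replaces a
      limit as \<open>e\<close> tends to 0.\<close>
    define D where "D = {s \<in> C. norm (g s) \<in> {Q t0..}}"
    have "compact D"
      unfolding D_def using C cont[OF gV]
      by (intro compact_Collect_closed continuous_intros) (auto intro: continuous_on_subset)
    moreover have "D \<noteq> {}"
      using pert[of 1] by (auto simp: D_def)
    moreover have "continuous_on D (\<lambda>t. norm (f t))"
      using C cont[OF f] by (intro continuous_intros) (auto simp: D_def intro: continuous_on_subset)
    ultimately obtain s where s: "s \<in> D" "\<And>t. t \<in> D \<Longrightarrow> norm (f t) \<le> norm (f s)"
      using continuous_attains_sup by metis
    have sK: "s \<in> K"
      using s C by (auto simp: D_def)
    have "v \<le> norm (f s)"
    proof (rule field_le_epsilon)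
      fix \<delta> :: real
      assume \<delta>: "\<delta> > 0"
      \<comment> \<open>Chosen so that \<open>e * R\<close> is at most \<delta>; the added 1 keeps
        the denominator positive.\<close>
      define e where "e = \<delta> / (\<bar>R\<bar> + 1)"
      have e: "e > 0"
        using \<delta> by (simp add: e_def add_nonneg_pos)
      have "e * R \<le> e * (\<bar>R\<bar> + 1)"
        using e by (intro mult_left_mono) auto
      also have "\<dots> = \<delta>"
        by (simp add: e_def)
      finally have "e * R \<le> \<delta>" .
      moreover obtain t where "t \<in> D" "v - e * R \<le> norm (f t)"
        using pert[OF e] by (auto simp: D_def)
      ultimately show "v \<le> norm (f s) + \<delta>"
        using s(2)[of t] by linarith
    qed
    \<comment> \<open>Both bounds for the equality case now hold: \<open>Q s\<close> is at most
      \<open>Q t0\<close> by the choice of \<open>t0\<close>, and \<open>Q t0\<close> is at most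
      \<open>norm (g s)\<close> by membership in \<open>D\<close>.\<close>
    then have "s \<in> M"
      using m(2)[OF sK] sK by (simp add: M_def v_def)
    then have "Q s \<le> Q t0"
      by (rule t0)
    moreover have "Q t0 \<le> norm (g s)"
      using s by (simp add: D_def)
    ultimately obtain d where "\<And>a. a \<in> A \<Longrightarrow> a s = d * a t0"
      using Cauchy_Schwarz_equality[OF A(1), of "\<lambda>a. a s" "\<lambda>a. a t0"]
      unfolding Q_def g_def by blast
    then have "s = t0"
      by (rule sep[OF t0K sK])
    then show "t0 \<in> C"
      using s by (simp add: D_def)
  qed
qed

section \<open>Coordinates and compactness of the unit ball in finite dimension\<close>

context normed_space_over
begin

lemma continuous_on_combination:
  "continuous_on S (\<lambda>c. \<Sum>b\<in>B. scl (c b) b)"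
  by (intro continuous_on_sum bounded_linear.continuous_on[OF bounded_linear_scale_left]
      continuous_on_subset[OF continuous_on_product_coordinates]) auto

text \<open>Combinations with one coefficient 1 and the others in the unit ball form a compact set
  that misses 0 by independence, hence stays away from 0. Dividing by the largest coefficient
  reduces the general case to this one.\<close>

lemma coefficient_bound:
  assumes "finite B" "independent B"
  obtains K where "0 \<le> K" "\<And>c b. b \<in> B \<Longrightarrow> norm (c b) \<le> K * norm (\<Sum>b'\<in>B. scl (c b') b')"
proof (cases "B = {}")
  case True
  then show thesis using that[of 0] by auto
next
  case False
  define X where "X b = Pi UNIV (\<lambda>b'. if b' = b then {1} else cball (0::'k) 1)" for b :: 'a
  define S where "S b = (\<lambda>c. \<Sum>b'\<in>B. scl (c b') b') ` X b" for b
  have "\<exists>\<delta>>0. \<forall>x\<in>S b. \<delta> \<le> norm x" if "b \<in> B" for b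
  proof -
    have "compact (S b)"
      unfolding S_def X_def by (intro compact_continuous_image continuous_on_combination compact_Pi) auto
    moreover have "0 \<notin> S b"
    proof
      assume "0 \<in> S b"
      then obtain c where "c \<in> X b" "(\<Sum>b'\<in>B. scl (c b') b') = 0"
        by (auto simp: S_def)
      with independentD[OF assms(2,1) order_refl this(2) that] show False
        by (auto simp: X_def Pi_iff split: if_splits)
    qed
    ultimately obtain \<delta> where "\<delta> > 0" "ball 0 \<delta> \<subseteq> - S b"
      using compact_imp_closed[of "S b"] open_contains_ball[of "- S b"] by (auto simp: closed_def)
    then show ?thesis
      by (force simp: subset_iff not_less)
  qed
  then obtain \<delta> where \<delta>: "\<And>b. b \<in> B \<Longrightarrow> \<delta> b > 0" "\<And>b x. b \<in> B \<Longrightarrow> x \<in> S b \<Longrightarrow> \<delta> b \<le> norm x"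
    by metis
  define \<epsilon> where "\<epsilon> = Min (\<delta> ` B)"
  have \<epsilon>: "\<epsilon> > 0" "\<And>b. b \<in> B \<Longrightarrow> \<epsilon> \<le> \<delta> b"
    using assms False \<delta> by (auto simp: \<epsilon>_def)
  show thesis
  proof (rule that[of "1 / \<epsilon>"])
    fix c :: "'a \<Rightarrow> 'k" and b
    assume b: "b \<in> B"
    let ?x = "\<Sum>b'\<in>B. scl (c b') b'"
    obtain b0 where b0: "b0 \<in> B" "\<And>b'. b' \<in> B \<Longrightarrow> norm (c b') \<le> norm (c b0)"
      using obtains_MAX[OF assms(1) False, of "\<lambda>b. norm (c b)"] Max_ge assms(1)
      by (metis finite_imageI image_eqI)
    have "\<epsilon> * norm (c b0) \<le> norm ?x"
    proof (cases "c b0 = 0")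
      case nz: False
      \<comment> \<open>Outside \<open>B\<close> the function \<open>c\<close> is uncontrolled, so
        it is replaced there by values allowed in \<open>X b0\<close>; the sum over \<open>B\<close>
        does not see this.\<close>
      let ?c = "\<lambda>b'. if b' \<in> B then c b' / c b0 else if b' = b0 then 1 else 0"
      have "?c \<in> X b0"
        using b0 nz by (auto simp: X_def norm_divide)
      then have "(\<Sum>b'\<in>B. scl (?c b') b') \<in> S b0"
        unfolding S_def by (rule imageI)
      moreover have "(\<Sum>b'\<in>B. scl (?c b') b') = scl (1 / c b0) ?x"
        by (simp add: scale_sum_right)
      ultimately have "\<epsilon> \<le> norm (scl (1 / c b0) ?x)"
        using \<delta>(2)[OF b0(1)] \<epsilon>(2)[OF b0(1)] by force
      then show ?thesis
        using nz by (simp add: norm_scale norm_divide field_simps)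
    qed simp
    moreover have "\<epsilon> * norm (c b) \<le> \<epsilon> * norm (c b0)"
      using b0(2)[OF b] \<epsilon> by simp
    ultimately have "\<epsilon> * norm (c b) \<le> norm ?x"
      by linarith
    then show "norm (c b) \<le> 1 / \<epsilon> * norm ?x"
      using \<epsilon>(1) by (simp add: field_simps)
  qed (use \<epsilon> in simp)
qed

lemma finite_dim_basis:
  assumes "finite_dim scl"
  obtains B where "finite B" "independent B" "span B = UNIV"
proof -
  obtain Bs where "finite_dimensional_vector_space scl Bs"
    using assms by (auto simp: finite_dim_def)
  then interpret F: finite_dimensional_vector_space scl Bs .
  show thesis
    using that F.finite_Basis F.independent_Basis F.span_Basis by blast
qed

text \<open>Provides the dual basis; boundedness is the coefficient bound applied to the expansion
  of \<open>x\<close>.\<close>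

lemma representation_in_dual_space:
  assumes B: "finite B" "independent B" "span B = UNIV" and b: "b \<in> B"
  shows "(\<lambda>x. representation B x b) \<in> dual_space scl"
proof -
  obtain K where "\<And>c b. b \<in> B \<Longrightarrow> norm (c b) \<le> K * norm (\<Sum>b'\<in>B. scl (c b') b')"
    using coefficient_bound[OF B(1,2)] by metis
  from this[OF b, of "representation B _"]
  have "norm (representation B x b) \<le> K * norm x" for x
    using B by (simp add: sum_representation_eq)
  moreover have "Vector_Spaces.linear scl (*) (\<lambda>x. representation B x b)"
    using B by unfold_locales
      (auto simp: representation_add representation_scale algebra_simps)
  ultimately show ?thesis
    by (auto simp: dual_space_def)
qed

text \<open>The ball is a closed subset of the image of a compact box of coefficients.\<close>

lemma compact_cball_finite_dim:
  assumes "finite_dim scl"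
  shows "compact (cball (0::'a) 1)"
proof -
  obtain B where B: "finite B" "independent B" "span B = UNIV"
    using finite_dim_basis[OF assms] .
  obtain K where K: "0 \<le> K" "\<And>c b. b \<in> B \<Longrightarrow> norm (c b) \<le> K * norm (\<Sum>b'\<in>B. scl (c b') b')"
    using coefficient_bound[OF B(1,2)] by metis
  let ?T = "(\<lambda>c. \<Sum>b\<in>B. scl (c b) b) ` Pi UNIV (\<lambda>_. cball (0::'k) K)"
  have "compact ?T"
    by (intro compact_continuous_image continuous_on_combination compact_Pi) auto
  moreover have "cball 0 1 \<subseteq> ?T"
  proof
    fix x :: 'a
    assume x: "x \<in> cball 0 1"
    have eq: "(\<Sum>b\<in>B. scl (representation B x b) b) = x"
      using B by (simp add: sum_representation_eq)
    \<comment> \<open>The box has a factor for every vector, not only for those in \<open>B\<close>;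
      elsewhere the coefficient is 0.\<close>
    have "norm (representation B x b) \<le> K" for b
    proof (cases "b \<in> B")
      case True
      then show ?thesis
        using K(2)[OF True, of "representation B x"] x K(1) mult_left_le[of "norm x" K]
        by (simp add: eq)
    next
      case False
      then show ?thesis
        using K(1) representation_ne_zero[of B x b] by fastforce
    qed
    then show "x \<in> ?T"
      using eq by (intro image_eqI[of _ _ "representation B x"]) auto
  qed
  ultimately show ?thesis
    using compact_Int_closed[OF _ closed_cball, of ?T 0 1] by (simp add: inf.absorb2)
qed

lemma compact_unit_ball:
  assumes "finite_dim scl"
  shows "compact (UNIV :: 'a unit_ball set)"
proof -
  have "continuous_on (cball 0 1) (Abs_unit_ball :: 'a \<Rightarrow> 'a unit_ball)"
    by (auto simp: continuous_on_iff dist_unit_ball_def Abs_unit_ball_inverse)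
  then have "compact (Abs_unit_ball ` cball (0::'a) 1)"
    by (rule compact_continuous_image) (rule compact_cball_finite_dim[OF assms])
  moreover have "Abs_unit_ball ` cball (0::'a) 1 = UNIV"
    by (metis of_ball of_ball_inverse UNIV_eq_I image_eqI)
  ultimately show ?thesis by simp
qed

section \<open>The dual ball and joint continuity of evaluation\<close>

text \<open>Replaces the operator norm by conditions at single points, which are closed under
  pointwise convergence.\<close>

lemma dual_ball_iff:
  "\<phi> \<in> dual_ball scl \<longleftrightarrow> Vector_Spaces.linear scl (*) \<phi> \<and> (\<forall>x. norm (\<phi> x) \<le> norm x)"
proof
  assume "\<phi> \<in> dual_ball scl"
  then have d: "\<phi> \<in> dual_space scl" "onorm \<phi> \<le> 1"
    by (auto simp: dual_ball_def)
  have "norm (\<phi> x) \<le> norm x" for x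
    using onorm[OF dual_space_bounded_linear[OF d(1)], of x] d(2)
      mult_right_mono[of "onorm \<phi>" 1 "norm x"] by simp
  with d show "Vector_Spaces.linear scl (*) \<phi> \<and> (\<forall>x. norm (\<phi> x) \<le> norm x)"
    by (simp add: dual_space_def)
next
  assume *: "Vector_Spaces.linear scl (*) \<phi> \<and> (\<forall>x. norm (\<phi> x) \<le> norm x)"
  then have "\<phi> \<in> dual_space scl"
    by (auto simp: dual_space_def intro: exI[of _ 1])
  with * show "\<phi> \<in> dual_ball scl"
    by (auto simp: dual_ball_def intro: onorm_le[of _ 1, simplified] onorm_bound)
qed

text \<open>Banach-Alaoglu: linearity is a family of closed equations inside a product of compact
  balls.\<close>

lemma compact_dual_ball: "compact (dual_ball scl)"
proof -
  let ?P = "Pi UNIV (\<lambda>x::'a. cball (0::'k) (norm x))"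
  have lin: "Vector_Spaces.linear scl (*) \<phi> \<longleftrightarrow>
      (\<forall>x y. \<phi> (x + y) = \<phi> x + \<phi> y) \<and> (\<forall>c x. \<phi> (scl c x) = c * \<phi> x)" for \<phi> :: "'a \<Rightarrow> 'k"
  proof -
    have "vector_space ((*) :: 'k \<Rightarrow> 'k \<Rightarrow> 'k)"
      by unfold_locales (auto simp: algebra_simps)
    then show ?thesis
      using vector_space_axioms
      by (auto simp: Vector_Spaces.linear_def module_hom_def module_hom_axioms_def
          vector_space_def module_def)
  qed
  have "dual_ball scl = ?P \<inter> ({\<phi>. \<forall>x y. \<phi> (x + y) = \<phi> x + \<phi> y} \<inter> {\<phi>. \<forall>c x. \<phi> (scl c x) = c * \<phi> x})"
    by (auto simp: dual_ball_iff lin Pi_iff)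
  moreover have "closed {\<phi> :: 'a \<Rightarrow> 'k. \<forall>x y. \<phi> (x + y) = \<phi> x + \<phi> y}"
    by (intro closed_Collect_all closed_Collect_eq continuous_on_add continuous_on_product_coordinates)
  moreover have "closed {\<phi> :: 'a \<Rightarrow> 'k. \<forall>c x. \<phi> (scl c x) = c * \<phi> x}"
    by (intro closed_Collect_all closed_Collect_eq continuous_on_mult_left continuous_on_product_coordinates)
  ultimately show ?thesis
    by (simp add: compact_Int_closed closed_Int compact_Pi)
qed

text \<open>Evaluation is jointly continuous because the functionals in the dual ball are equicontinuous.\<close>

lemma continuous_on_eval:
  fixes g :: "'b::topological_space \<Rightarrow> 'a"
  assumes g: "continuous_on UNIV g"
  shows "continuous_on (UNIV \<times> dual_ball scl) (\<lambda>(x, \<phi>). \<phi> (g x))"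
  unfolding continuous_on_def
proof clarify
  fix x0 :: 'b and \<phi>0
  assume \<phi>0: "\<phi>0 \<in> dual_ball scl"
  let ?F = "at (x0, \<phi>0) within UNIV \<times> dual_ball scl"
  have "continuous_on (UNIV \<times> dual_ball scl) (\<lambda>p. norm (g (fst p) - g x0) + norm (snd p (g x0) - \<phi>0 (g x0)))"
    by (intro continuous_on_add continuous_on_norm continuous_on_diff continuous_on_const
        continuous_on_compose2[OF g continuous_on_fst[OF continuous_on_id] subset_UNIV]
        continuous_on_compose2[OF continuous_on_product_coordinates continuous_on_snd[OF continuous_on_id] subset_UNIV])
  from this[unfolded continuous_on_def, rule_format, of "(x0, \<phi>0)"] \<phi>0
  have lim: "((\<lambda>p. norm (g (fst p) - g x0) + norm (snd p (g x0) - \<phi>0 (g x0))) \<longlongrightarrow> 0) ?F"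
    by simp
  \<comment> \<open>Split at \<open>snd p (g x0)\<close>; the first difference is controlled because
    every functional in the dual ball is a contraction.\<close>
  have bnd: "norm (snd p (g (fst p)) - \<phi>0 (g x0)) \<le> norm (g (fst p) - g x0) + norm (snd p (g x0) - \<phi>0 (g x0))"
    if "p \<in> UNIV \<times> dual_ball scl" for p
  proof -
    have d: "snd p \<in> dual_ball scl"
      using that by auto
    then have "linear (snd p)"
      using dual_space_bounded_linear bounded_linear.linear by (auto simp: dual_ball_def)
    then have "snd p (g (fst p)) - snd p (g x0) = snd p (g (fst p) - g x0)"
      by (simp add: linear_diff)
    then have "norm (snd p (g (fst p)) - snd p (g x0)) \<le> norm (g (fst p) - g x0)"
      using d by (simp add: dual_ball_iff)
    then show ?thesis
      using norm_triangle_ineq[of "snd p (g (fst p)) - snd p (g x0)" "snd p (g x0) - \<phi>0 (g x0)"]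
      by simp
  qed
  have "((\<lambda>p. snd p (g (fst p)) - \<phi>0 (g x0)) \<longlongrightarrow> 0) ?F"
    by (rule Lim_null_comparison[OF _ lim]) (auto simp: eventually_at_filter bnd intro!: always_eventually)
  then show "((\<lambda>(x, \<phi>). \<phi> (g x)) \<longlongrightarrow> \<phi>0 (g x0)) ?F"
    by (simp add: case_prod_unfold LIM_zero_cancel)
qed

section \<open>Compactness of \<open>Pi_set\<close> and separation of its points\<close>

text \<open>Attaining 1 at a unit vector forces \<open>onorm\<close> up to 1, so only closed
  conditions remain. The nesting fits two uses of \<open>compact_Collect_closed\<close>.\<close>

lemma Pi_set_alt:
  "Pi_set scl = {p \<in> {p \<in> UNIV \<times> dual_ball scl. norm (of_ball (fst p)) \<in> {1}}. (\<lambda>(x, \<phi>). \<phi> (of_ball x)) p \<in> {1}}"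
proof -
  have "onorm \<phi> = 1"
    if "\<phi> \<in> dual_space scl" "onorm \<phi> \<le> 1" "norm x = 1" "\<phi> x = 1" for \<phi> x
    using onorm[OF dual_space_bounded_linear[OF that(1)], of x] that by simp
  then show ?thesis
    by (auto simp: Pi_set_def dual_ball_def)
qed

lemma compact_Pi_set:
  assumes "finite_dim scl"
  shows "compact (Pi_set scl)"
  unfolding Pi_set_alt
proof (intro compact_Collect_closed)
  let ?X = "(UNIV :: 'a unit_ball set) \<times> dual_ball scl"
  show "compact ?X"
    by (rule compact_Times[OF compact_unit_ball[OF assms] compact_dual_ball])
  show "continuous_on ?X (\<lambda>p. norm (of_ball (fst p)))"
    by (rule continuous_on_norm[OF continuous_on_compose2[OF continuous_on_of_ball
          continuous_on_fst[OF continuous_on_id] subset_UNIV]])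
  show "continuous_on {p \<in> ?X. norm (of_ball (fst p)) \<in> {1}} (\<lambda>(x, \<phi>). \<phi> (of_ball x))"
    by (rule continuous_on_subset[OF continuous_on_eval[OF continuous_on_of_ball]]) auto
qed auto

text \<open>Lets \<open>tau\<close>-closed sets inherit compactness from
  \<open>Pi_set\<close>.\<close>

lemma tau_eq: "tau scl = top_of_set (Pi_set scl)"
proof -
  have "tau scl = subtopology (subtopology euclidean (UNIV \<times> dual_ball scl)) (Pi_set scl)"
    unfolding tau_def weak_star_ball_def euclidean_product_topology
    using prod_topology_subtopology(2)[of "euclidean :: 'a unit_ball topology" euclidean "dual_ball scl"]
    by simp
  moreover have "Pi_set scl \<subseteq> UNIV \<times> dual_ball scl"
    by (auto simp: Pi_set_alt)
  ultimately show ?thesis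
    by (simp add: subtopology_subtopology inf.absorb2)
qed


text \<open>The constants give \<phi>' = d \<phi> with d nonzero. Dividing the tensor equations by a
  nonzero d \<phi>(j) equates the coordinates of x and x', and then \<phi>(x) = \<phi>'(x) = 1
  forces d = 1.\<close>

lemma Pi_set_separation:
  assumes B: "finite B" "independent B" "span B = UNIV"
    and p: "(x, \<phi>) \<in> Pi_set scl" and q: "(x', \<phi>') \<in> Pi_set scl"
    and const: "\<And>b. b \<in> B \<Longrightarrow> \<phi>' b = d * \<phi> b"
    and tens: "\<And>i j. i \<in> B \<Longrightarrow> j \<in> B \<Longrightarrow>
      representation B (of_ball x') i * \<phi>' j = d * (representation B (of_ball x) i * \<phi> j)"
  shows "(x', \<phi>') = (x, \<phi>)"
proof -
  have expand: "\<psi> v = (\<Sum>b\<in>B. representation B v b * \<psi> b)" if "\<psi> \<in> dual_space scl" for \<psi> v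
  proof -
    interpret L: Vector_Spaces.linear scl "(*)" \<psi>
      using that by (simp add: dual_space_def)
    have "\<psi> v = \<psi> (\<Sum>b\<in>B. scl (representation B v b) b)"
      using B by (simp add: sum_representation_eq)
    then show ?thesis
      by (simp add: L.sum L.scale)
  qed
  have \<phi>: "\<phi> \<in> dual_space scl" "\<phi> (of_ball x) = 1" and \<phi>': "\<phi>' \<in> dual_space scl" "\<phi>' (of_ball x') = 1"
    using p q by (auto simp: Pi_set_def)
  have \<phi>'_eq: "\<phi>' v = d * \<phi> v" for v
    by (simp add: expand[OF \<phi>(1), of v] expand[OF \<phi>'(1), of v] const sum_distrib_left mult.left_commute)
  have d: "d \<noteq> 0"
    using \<phi>'(2) \<phi>'_eq[of "of_ball x'"] by auto
  have "(\<Sum>b\<in>B. representation B (of_ball x) b * \<phi> b) \<noteq> 0"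
    using \<phi>(2) expand[OF \<phi>(1), of "of_ball x"] by simp
  then obtain j where j: "j \<in> B" "\<phi> j \<noteq> 0"
    by (rule sum.not_neutral_contains_not_neutral) auto
  have "representation B (of_ball x') i = representation B (of_ball x) i" if "i \<in> B" for i
    using tens[OF that j(1)] j(2) d by (simp add: \<phi>'_eq)
  then have "(\<Sum>b\<in>B. scl (representation B (of_ball x') b) b) = (\<Sum>b\<in>B. scl (representation B (of_ball x) b) b)"
    by simp
  then have x: "x' = x"
    using B by (simp add: sum_representation_eq of_ball_inject)
  then have "d = 1"
    using \<phi>(2) \<phi>'(2) \<phi>'_eq[of "of_ball x"] by simp
  then show ?thesis
    using x \<phi>'_eq by auto
qed

section \<open>Bounds for \<open>num_sup\<close>\<close>

lemma Pi_set_apply_le: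
  assumes "(x, \<phi>) \<in> Pi_set scl"
  shows "norm (\<phi> (apply_bcontfun f x)) \<le> norm f"
proof -
  have "norm (\<phi> (apply_bcontfun f x)) \<le> norm (apply_bcontfun f x)"
    using assms by (auto simp: Pi_set_alt dual_ball_iff)
  also have "\<dots> \<le> norm f"
    by (rule norm_bounded)
  finally show ?thesis .
qed

lemma num_sup_bdd_above:
  assumes "C \<subseteq> Pi_set scl"
  shows "bdd_above (insert 0 ((\<lambda>(x, \<phi>). norm (\<phi> (apply_bcontfun f x))) ` C))"
  using assms by (auto simp: bdd_above_insert intro!: bdd_aboveI[of _ "norm f"] Pi_set_apply_le)

lemma num_sup_upper:
  assumes "C \<subseteq> Pi_set scl" "(x, \<phi>) \<in> C"
  shows "norm (\<phi> (apply_bcontfun f x)) \<le> num_sup C f"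
  unfolding num_sup_def using assms
  by (intro cSup_upper num_sup_bdd_above) force+

lemma num_sup_nonneg:
  assumes "C \<subseteq> Pi_set scl"
  shows "0 \<le> num_sup C f"
  unfolding num_sup_def using assms
  by (intro cSup_upper num_sup_bdd_above) auto

lemma num_sup_least:
  assumes "0 \<le> r" "\<And>x \<phi>. (x, \<phi>) \<in> C \<Longrightarrow> norm (\<phi> (apply_bcontfun f x)) \<le> r"
  shows "num_sup C f \<le> r"
  unfolding num_sup_def using assms by (intro cSup_least) auto

end

section \<open>The intersection of all closed numerical boundaries\<close>

theorem theorem6p1:
  fixes scl :: "'k::{real_normed_field, euclidean_space} \<Rightarrow> 'a::banach \<Rightarrow> 'a"
    and H :: "('a unit_ball \<Rightarrow>\<^sub>C 'a) set"
  assumes "normed_space_over scl"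
    and "finite_dim scl"
    and "closed_subspace scl H"
    and "\<And>x. const_bcontfun x \<in> H"
    and "\<And>y z. y \<in> dual_space scl \<Longrightarrow> tensor scl y z \<in> H"
  shows "has_numerical_Shilov_boundary scl H"
proof -
  interpret normed_space_over scl by fact
  interpret W: vector_space "scale_bcontfun scl :: 'k \<Rightarrow> ('a unit_ball \<Rightarrow>\<^sub>C 'a) \<Rightarrow> _"
    by (rule vector_space_scale_bcontfun)
  have H: "W.subspace H"
    using assms(3) by (simp add: closed_subspace_def)
  define P where "P = Pi_set scl"
  define ev where "ev f = (\<lambda>(x, \<phi>). \<phi> (apply_bcontfun f x) :: 'k)" for f :: "'a unit_ball \<Rightarrow>\<^sub>C 'a"
  \<comment> \<open>Agreement is asked only on \<open>P\<close>, since \<open>ev\<close> is linear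
    in \<open>f\<close> only where the second component is a linear functional.\<close>
  define V where "V = {h. \<exists>f\<in>H. \<forall>p\<in>P. h p = ev f p}"
  have compact: "compact P"
    unfolding P_def by (rule compact_Pi_set[OF assms(2)])
  have evV: "ev f \<in> V" if "f \<in> H" for f
    using that by (auto simp: V_def)
  have cont_ev: "continuous_on P (ev f)" for f
    unfolding ev_def P_def
    by (rule continuous_on_subset[OF continuous_on_eval]) (auto simp: Pi_set_alt)
  have cont: "continuous_on P h" if "h \<in> V" for h
    using that cont_ev by (auto simp: V_def cong: continuous_on_cong)
  have hom: "Vector_Spaces.linear scl (*) \<phi>" if "(x, \<phi>) \<in> P" for x \<phi>
    using that by (auto simp: P_def Pi_set_def dual_space_def)
  have ev_add: "ev (f + g) p = ev f p + ev g p" if "p \<in> P" for f g p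
  proof (cases p)
    case (Pair x \<phi>)
    interpret L: Vector_Spaces.linear scl "(*)" \<phi>
      using hom that Pair by blast
    show ?thesis by (simp add: ev_def Pair L.add plus_bcontfun.rep_eq)
  qed
  have ev_scale: "ev (scale_bcontfun scl c f) p = c * ev f p" if "p \<in> P" for c f p
  proof (cases p)
    case (Pair x \<phi>)
    interpret L: Vector_Spaces.linear scl "(*)" \<phi>
      using hom that Pair by blast
    show ?thesis by (simp add: ev_def Pair L.scale)
  qed
  have add: "(\<lambda>t. h t + k t) \<in> V" if hk: "h \<in> V" "k \<in> V" for h k
  proof -
    obtain f g where "f \<in> H" "g \<in> H" "\<forall>p\<in>P. h p = ev f p" "\<forall>p\<in>P. k p = ev g p"
      using hk by (auto simp: V_def)
    then show ?thesis
      unfolding V_def mem_Collect_eq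
      by (intro bexI[of _ "f + g"] ballI) (simp_all add: ev_add W.subspace_add[OF H])
  qed
  have mult: "(\<lambda>t. c * h t) \<in> V" if h: "h \<in> V" for c h
  proof -
    obtain f where "f \<in> H" "\<forall>p\<in>P. h p = ev f p"
      using h by (auto simp: V_def)
    then show ?thesis
      unfolding V_def mem_Collect_eq
      by (intro bexI[of _ "scale_bcontfun scl c f"] ballI) (simp_all add: ev_scale W.subspace_scale[OF H])
  qed
  obtain B where B: "finite B" "independent B" "span B = UNIV"
    using finite_dim_basis[OF assms(2)] .
  define co where "co i x = representation B x i" for i x
  have co: "co i \<in> dual_space scl" if "i \<in> B" for i
    unfolding co_def[abs_def] by (rule representation_in_dual_space[OF B that])
  define A where "A = ev ` (const_bcontfun ` B \<union> (\<lambda>(i, j). tensor scl (co i) j) ` (B \<times> B))"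
  have A: "finite A" "A \<subseteq> V"
    using B assms(4,5) co by (auto simp: A_def intro!: evV)
  have sep: "t = s" if st: "s \<in> P" "t \<in> P" and eq: "\<And>a. a \<in> A \<Longrightarrow> a t = d * a s" for s t d
  proof (cases s, cases t)
    fix x \<phi> x' \<phi>'
    assume s: "s = (x, \<phi>)" and t: "t = (x', \<phi>')"
    have ev_tensor: "ev (tensor scl (co i) j) (u, \<psi>) = co i (of_ball u) * \<psi> j"
      if "i \<in> B" "(u, \<psi>) \<in> P" for i j u \<psi>
    proof -
      interpret L: Vector_Spaces.linear scl "(*)" \<psi>
        using hom that by blast
      show ?thesis
        by (simp add: ev_def apply_tensor co that L.scale)
    qed
    have "(x', \<phi>') = (x, \<phi>)"
    proof (rule Pi_set_separation[OF B])
      show "(x, \<phi>) \<in> Pi_set scl" "(x', \<phi>') \<in> Pi_set scl"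
        using st s t by (auto simp: P_def)
      show "\<phi>' b = d * \<phi> b" if "b \<in> B" for b
      proof -
        have "ev (const_bcontfun b) \<in> A"
          unfolding A_def using that by (intro imageI UnI1)
        from eq[OF this] show ?thesis
          by (simp add: s t ev_def const_bcontfun.rep_eq)
      qed
      show "representation B (of_ball x') i * \<phi>' j = d * (representation B (of_ball x) i * \<phi> j)"
        if "i \<in> B" "j \<in> B" for i j
      proof -
        have "ev (tensor scl (co i) j) \<in> A"
          unfolding A_def using that
          by (intro imageI UnI2 image_eqI[of _ "\<lambda>(i, j). tensor scl (co i) j" "(i, j)"]) auto
        from eq[OF this] show ?thesis
          using st by (simp add: s t ev_tensor that co_def)
      qed
    qed
    then show "t = s"
      by (simp add: s t)
  qed
  define S where "S = \<Inter>{C. closed_numerical_boundary scl H C}"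
  have whole: "closed_numerical_boundary scl H P"
    by (simp add: closed_numerical_boundary_def numerical_boundary_def numerical_radius_def tau_eq P_def)
  then have SP: "S \<subseteq> P"
    by (auto simp: S_def)
  \<comment> \<open>\<open>P\<close> is empty when the space is trivial, hence the assumption
    \<open>ne\<close>.\<close>
  have peak: "\<exists>(x, \<phi>)\<in>S. \<forall>p\<in>P. norm (ev f p) \<le> norm (\<phi> (apply_bcontfun f x))"
    if f: "f \<in> H" and ne: "P \<noteq> {}" for f
  proof -
    have "\<exists>t0\<in>P. (\<forall>t\<in>P. norm (ev f t) \<le> norm (ev f t0)) \<and>
        (\<forall>C. compact C \<and> C \<subseteq> P \<and> (\<forall>h\<in>V. \<forall>t\<in>P. \<exists>s\<in>C. norm (h t) \<le> norm (h s)) \<longrightarrow> t0 \<in> C)"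
      by (rule maximiser_in_all_closed_boundaries[where A = A])
        (fact compact ne cont add mult A sep evV[OF f])+
    then obtain t0 where t0: "t0 \<in> P" "\<forall>t\<in>P. norm (ev f t) \<le> norm (ev f t0)"
      and bd: "\<And>C. compact C \<and> C \<subseteq> P \<and> (\<forall>h\<in>V. \<forall>t\<in>P. \<exists>s\<in>C. norm (h t) \<le> norm (h s)) \<Longrightarrow> t0 \<in> C"
      by blast
    have "t0 \<in> C" if C: "closed_numerical_boundary scl H C" for C
    proof (intro bd conjI ballI)
      have "closedin (top_of_set P) C"
        using C by (simp add: closed_numerical_boundary_def tau_eq P_def)
      then show cC: "compact C" and CP: "C \<subseteq> P"
        using closedin_compact[OF compact] closedin_subset by fastforce+
      have le: "norm (ev g p) \<le> num_sup C g" if "g \<in> H" "p \<in> P" for g p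
      proof -
        have "norm (ev g p) \<le> num_sup (Pi_set scl) g"
          using num_sup_upper[OF order_refl] that by (cases p) (auto simp: ev_def P_def)
        then show ?thesis
          using C that by (simp add: closed_numerical_boundary_def numerical_boundary_def numerical_radius_def)
      qed
      \<comment> \<open>The constant function with value \<open>x\<close> evaluates to 1 at (x,
        \<phi>), whereas the supremum over the empty set is 0 by convention.\<close>
      have "C \<noteq> {}"
      proof
        assume "C = {}"
        obtain x \<phi> where p: "(x, \<phi>) \<in> P"
          using ne by auto
        then have "ev (const_bcontfun (of_ball x)) (x, \<phi>) = 1"
          by (simp add: ev_def const_bcontfun.rep_eq P_def Pi_set_def)
        with le[OF assms(4) p, of "of_ball x"] show False
          by (simp add: \<open>C = {}\<close> num_sup_def)
      qed
      fix h t
      assume "h \<in> V" and t: "t \<in> P"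
      then obtain g where g: "g \<in> H" "\<And>p. p \<in> P \<Longrightarrow> h p = ev g p"
        by (auto simp: V_def)
      \<comment> \<open>Compactness of \<open>C\<close> turns the supremum in the definition of a
        boundary into an attained maximum.\<close>
      have "continuous_on C (\<lambda>p. norm (ev g p))"
        by (intro continuous_on_norm continuous_on_subset[OF cont_ev CP])
      then obtain s where s: "s \<in> C" "\<And>p. p \<in> C \<Longrightarrow> norm (ev g p) \<le> norm (ev g s)"
        using continuous_attains_sup[OF cC \<open>C \<noteq> {}\<close>] by blast
      have "num_sup C g \<le> norm (ev g s)"
        using s(2) by (intro num_sup_least) (force simp: ev_def)+
      then show "\<exists>s\<in>C. norm (h t) \<le> norm (h s)"
        using le[OF g(1) t] s(1) g(2)[OF t] g(2)[of s] CP by (intro bexI[of _ s]) auto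
    qed
    then have "t0 \<in> S"
      by (simp add: S_def)
    then show ?thesis
      using t0 by (intro bexI[of _ t0]) (auto simp: ev_def split: prod.splits)
  qed
  have "numerical_boundary scl H S"
    unfolding numerical_boundary_def numerical_radius_def
  proof (intro conjI ballI order_antisym)
    show SP': "S \<subseteq> Pi_set scl"
      using SP by (simp add: P_def)
    fix f
    assume f: "f \<in> H"
    show "num_sup S f \<le> num_sup (Pi_set scl) f"
      using SP' by (intro num_sup_least num_sup_nonneg num_sup_upper) auto
    show "num_sup (Pi_set scl) f \<le> num_sup S f"
    proof (intro num_sup_least num_sup_nonneg SP')
      fix x \<phi>
      assume p: "(x, \<phi>) \<in> Pi_set scl"
      then obtain y \<psi> where y: "(y, \<psi>) \<in> S" "\<And>p. p \<in> P \<Longrightarrow> norm (ev f p) \<le> norm (\<psi> (apply_bcontfun f y))"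
        using peak[OF f] by (auto simp: P_def)
      have "norm (\<phi> (apply_bcontfun f x)) \<le> norm (\<psi> (apply_bcontfun f y))"
        using y(2)[of "(x, \<phi>)"] p by (simp add: ev_def P_def)
      also have "\<dots> \<le> num_sup S f"
        by (rule num_sup_upper[OF SP' y(1)])
      finally show "norm (\<phi> (apply_bcontfun f x)) \<le> num_sup S f" .
    qed
  qed
  moreover have "closedin (tau scl) S"
    \<comment> \<open>\<open>whole\<close> shows that the intersected family is nonempty.\<close>
    unfolding S_def using whole by (intro closedin_Inter) (auto simp: closed_numerical_boundary_def)
  ultimately have "closed_numerical_boundary scl H S"
    by (simp add: closed_numerical_boundary_def)
  then show ?thesis
    unfolding has_numerical_Shilov_boundary_def by (intro exI[of _ S]) (auto simp: S_def)
qed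

end
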